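(* Consider a single advertiser with capacity-to-impression ratio $\rho\in(0,1)$ and no exchange, and let $v=\bar G^{-1}(\rho\mid\theta)$. The relative efficiency $\varepsilon(\theta)=u'(\theta)/u(\theta)$ of the non-parametric estimator (with respect to the parametric one) is $$\varepsilon(\theta)=\rho(1-\rho)\,I(\theta)\left(\frac{\partial\bar G}{\partial\theta}(v\mid\theta)\right)^{-2}\ \ge\ 1,$$ and it is exactly equal to the relative efficiency in terms of the policies' performance, i.e. to the ratio of the variance of the limiting distribution of $\sqrt M(\bar J(\hat v_M)-\bar J(v))$ to the variance of the limiting distribution of $\sqrt M(\bar J(\hat v_M^{\mathrm{mle}})-\bar J(v))$ as $M\to\infty$.
   Context: Quality $Q$ is a real random variable with continuous density $g(x\mid\theta)$ and strictly monotonic c.d.f. $G(x\mid\theta)$, $\bar G=1-G$, where $\theta$ is an unknown real parameter. A sample $q_1,\dots,q_M$ of i.i.d. draws of $Q$ is available. $I(\theta)=\mathbb{E}\big[(\frac{\partial}{\partial\theta}\ln g(Q\mid\theta))^2\big]$ is the Fisher information. The optimal bid-price is the $(1-\rho)$-quantile $v=\bar G^{-1}(\rho\mid\theta)$ of $Q$. **Parametric estimator.** $\hat v_M^{\mathrm{mle}}=\bar G^{-1}(\rho\mid\hat\theta_M^{\mathrm{mle}})$, where $\hat\theta_M^{\mathrm{mle}}$ maximizes $\sum_{m=1}^M\log g(q_m\mid\theta)$. Under the usual regularity conditions, which are assumed, $\sqrt M(\hat v_M^{\mathrm{mle}}-v)\Rightarrow\mathcal{N}(0,u(\theta))$, with $u(\theta)=\big(\frac{\partial\bar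 G^{-1}}{\partial\theta}(\rho\mid\theta)\big)^2I(\theta)^{-1}$ the Cramér–Rao lower bound on the variance of any unbiased estimator of $v$. **Non-parametric estimator.** $\hat v_M\in\arg\min_{v}\frac1M\sum_{m=1}^M\max\{q_m-v,0\}+\rho v$ (the sample $(1-\rho)$-quantile). Under the usual regularity conditions, which are assumed, $\sqrt M(\hat v_M-v)\Rightarrow\mathcal{N}(0,u'(\theta))$ with $u'(\theta)=\rho(1-\rho)/g(v\mid\theta)^2$. **Performance.** For a bid-price $u$, $\bar J(u)$ is the limiting average yield per impression, as the number of impressions grows to infinity, of the policy that assigns an impression of quality $q$ to the advertiser iff $q\ge u$, until the advertiser has received a fraction $\rho$ of all impressions (after which all are discarded) or a fraction $1-\rho$ of all impressions has been discarded (after which all are assigned). It is given by $$\bar J(u)=\begin{cases}\rho\,\mathbb{E}_\theta[Q\mid Q\ge u],&u<v,\\ \mathbb{E}_\theta[Q]-(1-\rho)\,\mathbb{E}_\theta[Q\mid Q\le u],&u\ge v.\end{cases}$$ *)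

theory Defs
  imports "HOL-Probability.Probability"
begin

(* A parametric family of densities is a function g with g t x the density at x under
   the parameter value t. *)

definition law :: "(real \<Rightarrow> real) \<Rightarrow> real measure" where
  "law f = density lborel (\<lambda>x. ennreal (f x))"

definition ccdf :: "(real \<Rightarrow> real) \<Rightarrow> real \<Rightarrow> real" where
  "ccdf f x = 1 - cdf (law f) x"

definition ccdf_inv :: "(real \<Rightarrow> real) \<Rightarrow> real \<Rightarrow> real" where
  "ccdf_inv f r = inv (ccdf f) r"

definition fisher_info :: "(real \<Rightarrow> real \<Rightarrow> real) \<Rightarrow> real \<Rightarrow> real" where
  "fisher_info g \<theta> = (LINT x|law (g \<theta>). (deriv (\<lambda>t. ln (g t x)) \<theta>)\<^sup>2)"

(* Extended-real valued, because ln 0 = 0 on the reals, whereas a parameter that gives an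
   observation density zero must have log-likelihood minus infinity. *)
definition log_likelihood :: "(real \<Rightarrow> real \<Rightarrow> real) \<Rightarrow> nat \<Rightarrow> (nat \<Rightarrow> real) \<Rightarrow> real \<Rightarrow> ereal" where
  "log_likelihood g M x t =
     (\<Sum>m<M. if g t (x m) > 0 then ereal (ln (g t (x m))) else -\<infinity>)"

definition empirical_objective :: "real \<Rightarrow> nat \<Rightarrow> (nat \<Rightarrow> real) \<Rightarrow> real \<Rightarrow> real" where
  "empirical_objective \<rho> M x w = 1 / real M * (\<Sum>m<M. max (x m - w) 0) + \<rho> * w"

(* The asymptotic variance u(theta) of the parametric estimator. *)
definition avar_mle :: "(real \<Rightarrow> real \<Rightarrow> real) \<Rightarrow> real \<Rightarrow> real \<Rightarrow> real" where
  "avar_mle g \<rho> \<theta> = (deriv (\<lambda>t. ccdf_inv (g t) \<rho>) \<theta>)\<^sup>2 * inverse (fisher_info g \<theta>)"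

(* The asymptotic variance u'(theta) of the non-parametric estimator. *)
definition avar_np :: "(real \<Rightarrow> real \<Rightarrow> real) \<Rightarrow> real \<Rightarrow> real \<Rightarrow> real" where
  "avar_np g \<rho> \<theta> = \<rho> * (1 - \<rho>) / (g \<theta> (ccdf_inv (g \<theta>) \<rho>))\<^sup>2"

definition rel_efficiency :: "(real \<Rightarrow> real \<Rightarrow> real) \<Rightarrow> real \<Rightarrow> real \<Rightarrow> real" where
  "rel_efficiency g \<rho> \<theta> = avar_np g \<rho> \<theta> / avar_mle g \<rho> \<theta>"

(* Expectation of the identity conditional on an event A of positive probability. *)
definition cond_mean :: "real measure \<Rightarrow> real set \<Rightarrow> real" where
  "cond_mean D A = (LINT x:A|D. x) / measure D A"

(* Limiting average yield per impression of the bid-price w: below the optimal bid-price the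
   capacity runs out first, above it the impressions that may be discarded do. *)
definition Jbar :: "(real \<Rightarrow> real) \<Rightarrow> real \<Rightarrow> real \<Rightarrow> real" where
  "Jbar f \<rho> w =
     (if w < ccdf_inv f \<rho>
      then \<rho> * cond_mean (law f) {w..}
      else (LINT x|law f. x) - (1 - \<rho>) * cond_mean (law f) {..w})"

definition converges_in_law :: "'a measure \<Rightarrow> (nat \<Rightarrow> 'a \<Rightarrow> real) \<Rightarrow> real measure \<Rightarrow> bool" where
  "converges_in_law P X L \<longleftrightarrow>
     real_distribution L \<and> weak_conv_m (\<lambda>M. distr P borel (X M)) L"

definition centered_normal :: "real \<Rightarrow> real measure" where
  "centered_normal s = density lborel (\<lambda>x. ennreal (normal_density 0 (sqrt s) x))"

(* Weak limits are unique, so at most one s satisfies this. *)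
definition has_limiting_variance :: "'a measure \<Rightarrow> (nat \<Rightarrow> 'a \<Rightarrow> real) \<Rightarrow> real \<Rightarrow> bool" where
  "has_limiting_variance P X s \<longleftrightarrow>
     (\<exists>L. converges_in_law P X L \<and> integrable L (\<lambda>x. x\<^sup>2) \<and>
          prob_space.variance L (\<lambda>x. x) = s)"

end

(*
  For the identity, differentiating ccdf(w(t) | t) = rho gives the derivative of the quantile as
  ccdf'(v) / g(v). Domination of the parameter derivative makes t -> g t differentiable in L^1,
  hence the tail probabilities are differentiable uniformly in their threshold, which replaces the
  implicit function theorem. The lower bound is Cauchy-Schwarz for the score and the indicator of
  {v<..}.

  The performance Jbar has a kink at its maximiser v, with left slope a > 0 and right slope b. By
  Skorohod's theorem the scaled performance error therefore converges to phi(N), where N is the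
  Gaussian limit of the scaled estimation error and phi is the piecewise linear map with slopes a
  and b. As phi is positively homogeneous, the variance of phi(N) is a constant multiple of that
  of N, with a constant that depends only on a and b and cancels in the ratio.
*)
theory Submission
  imports Defs
begin

subsection \<open>The delta method at a kink\<close>

text \<open>A continuous mapping theorem in which the map may change with \<open>n\<close>.
  Skorohod's theorem replaces the \<open>X n\<close> by variables with the same laws that converge
  pointwise, so \<open>lim\<close> applies at each point; dominated convergence then treats bounded
  continuous test functions.\<close>

lemma converges_in_law_mapping:
  fixes X :: "nat \<Rightarrow> 'a \<Rightarrow> real" and h :: "nat \<Rightarrow> real \<Rightarrow> real"
  assumes P: "prob_space P" and X: "\<And>n. X n \<in> borel_measurable P"
    and conv: "converges_in_law P X L"
    and h: "\<And>n. h n \<in> borel_measurable borel" and \<phi>: "\<phi> \<in> borel_measurable borel"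
    and lim: "\<And>y x. y \<longlonglongrightarrow> x \<Longrightarrow> (\<lambda>n. h n (y n)) \<longlonglongrightarrow> \<phi> x"
  shows "converges_in_law P (\<lambda>n \<omega>. h n (X n \<omega>)) (distr L borel \<phi>)"
proof -
  interpret P: prob_space P by fact
  have L: "real_distribution L" and weak: "weak_conv_m (\<lambda>n. distr P borel (X n)) L"
    using conv by (auto simp: converges_in_law_def)
  interpret L: real_distribution L by fact
  have dX: "real_distribution (distr P borel (X n))" for n
    by (rule P.real_distribution_distr) (use X in simp)
  obtain \<Omega> :: "real measure" and Y :: "nat \<Rightarrow> real \<Rightarrow> real" and Z :: "real \<Rightarrow> real"
    where \<Omega>: "prob_space \<Omega>" and Y [measurable]: "\<And>n. Y n \<in> borel_measurable \<Omega>"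
      and dY: "\<And>n. distr \<Omega> borel (Y n) = distr P borel (X n)"
      and Z: "Z \<in> measurable \<Omega> lborel" and dZ: "distr \<Omega> borel Z = L"
      and YZ: "\<And>x. x \<in> space \<Omega> \<Longrightarrow> (\<lambda>n. Y n x) \<longlonglongrightarrow> Z x"
    using Skorohod[OF dX L weak] by metis
  interpret \<Omega>: prob_space \<Omega> by fact
  have [measurable]: "Z \<in> borel_measurable \<Omega>"
    using Z by simp
  note [measurable] = h \<phi> X
  have rd: "real_distribution (distr L borel \<phi>)"
    using L.real_distribution_distr[of \<phi>] \<phi> by simp
  have dL: "distr L borel \<phi> = distr \<Omega> borel (\<lambda>x. \<phi> (Z x))"
    unfolding dZ[symmetric] by (subst distr_distr) (auto simp: comp_def)
  have dh: "distr P borel (\<lambda>\<omega>. h n (X n \<omega>)) = distr \<Omega> borel (\<lambda>x. h n (Y n x))" for n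
  proof -
    have "distr P borel (\<lambda>\<omega>. h n (X n \<omega>)) = distr (distr P borel (X n)) borel (h n)"
      by (subst distr_distr) (auto simp: comp_def)
    also have "\<dots> = distr \<Omega> borel (\<lambda>x. h n (Y n x))"
      unfolding dY[symmetric] by (subst distr_distr) (auto simp: comp_def)
    finally show ?thesis .
  qed
  have rdh: "real_distribution (distr P borel (\<lambda>\<omega>. h n (X n \<omega>)))" for n
    by (rule P.real_distribution_distr) simp
  have "weak_conv_m (\<lambda>n. distr P borel (\<lambda>\<omega>. h n (X n \<omega>))) (distr L borel \<phi>)"
  proof (rule integral_bdd_continuous_conv_imp_weak_conv[OF rdh rd])
    fix f :: "real \<Rightarrow> real"
    assume f: "\<And>x. isCont f x" and b: "\<And>x. \<bar>f x\<bar> \<le> 1"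
    have [measurable]: "f \<in> borel_measurable borel"
      using f by (intro borel_measurable_continuous_onI) (auto simp: continuous_on_eq_continuous_at)
    have "(\<lambda>n. \<integral>x. f (h n (Y n x)) \<partial>\<Omega>) \<longlonglongrightarrow> (\<integral>x. f (\<phi> (Z x)) \<partial>\<Omega>)"
    proof (rule integral_dominated_convergence[where w = "\<lambda>_. 1"])
      show "AE x in \<Omega>. (\<lambda>n. f (h n (Y n x))) \<longlonglongrightarrow> f (\<phi> (Z x))"
        by (intro AE_I2 isCont_tendsto_compose[OF f] lim YZ)
    qed (use b in auto)
    then show "(\<lambda>n. integral\<^sup>L (distr P borel (\<lambda>\<omega>. h n (X n \<omega>))) f)
        \<longlonglongrightarrow> integral\<^sup>L (distr L borel \<phi>) f"
      unfolding dh dL by (simp add: integral_distr)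
  qed
  with rd show ?thesis
    by (simp add: converges_in_law_def)
qed

section \<open>Images of centred normal laws under a piecewise linear map\<close>

lemma prob_space_centered_normal: "s > 0 \<Longrightarrow> prob_space (centered_normal s)"
  unfolding centered_normal_def by (rule prob_space_normal_density) simp

lemma sets_centered_normal [simp, measurable_cong]: "sets (centered_normal s) = sets borel"
  by (simp add: centered_normal_def)

text \<open>Reduces every centred normal law to the standard one, so that the variance parameter
  becomes a scale factor.\<close>

lemma centered_normal_scale:
  assumes "s > 0"
  shows "centered_normal s = distr (centered_normal 1) borel (\<lambda>x. sqrt s * x)"
proof -
  interpret prob_space "centered_normal 1"
    by (rule prob_space_centered_normal) simp
  \<comment> \<open>\<open>normal_density_affine\<close> speaks of a random variable, so the
    identity on \<open>centered_normal 1\<close> is presented as a standard normal one.\<close>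
  have "distr (centered_normal 1) lborel (\<lambda>x. x) = distr (centered_normal 1) (centered_normal 1) (\<lambda>x. x)"
    by (rule distr_cong) auto
  then have "distributed (centered_normal 1) lborel (\<lambda>x. x) std_normal_density"
    unfolding distributed_def by (simp add: distr_id2) (simp add: centered_normal_def)
  from normal_density_affine[OF this, of "sqrt s" 0] assms
  have "distr (centered_normal 1) lborel (\<lambda>x. sqrt s * x) = centered_normal s"
    by (simp add: distributed_def centered_normal_def)
  moreover have "distr (centered_normal 1) lborel (\<lambda>x. sqrt s * x) = distr (centered_normal 1) borel (\<lambda>x. sqrt s * x)"
    by (rule distr_cong) auto
  ultimately show ?thesis by simp
qed

text \<open>The linearisation of a function at a point where its left and right slopes
  differ.\<close>

definition kink :: "real \<Rightarrow> real \<Rightarrow> real \<Rightarrow> real" where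
  "kink a b x = (if x < 0 then a * x else b * x)"

lemma measurable_kink [measurable]: "kink a b \<in> borel_measurable borel"
  unfolding kink_def[abs_def] by measurable

lemma kink_scale: "c > 0 \<Longrightarrow> kink a b (c * x) = c * kink a b x"
  by (simp add: kink_def mult_less_0_iff)

lemma isCont_kink: "isCont (kink a b) x"
proof -
  have "kink a b = (\<lambda>x. a * min x 0 + b * max x 0)"
    by (auto simp: kink_def fun_eq_iff)
  then show ?thesis by (auto intro!: continuous_intros)
qed

text \<open>The kink grows at most linearly, so the first absolute and the second moment of the
  standard normal law dominate it and its square.\<close>

lemma integrable_kink_normal:
  "integrable (centered_normal 1) (kink a b)"
  "integrable (centered_normal 1) (\<lambda>x. (kink a b x)\<^sup>2)"
proof -
  have le: "\<bar>kink a b x\<bar> \<le> (\<bar>a\<bar> + \<bar>b\<bar>) * \<bar>x\<bar>" for x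
    by (auto simp: kink_def abs_mult distrib_right mult_nonneg_nonpos)
  have "integrable (centered_normal 1) (\<lambda>x. (\<bar>a\<bar> + \<bar>b\<bar>) * \<bar>x\<bar>)"
    using integrable_std_normal_moment_abs[of 1]
    by (auto simp: centered_normal_def integrable_real_density)
  then show "integrable (centered_normal 1) (kink a b)"
    by (rule Bochner_Integration.integrable_bound) (use le in auto)
  have "integrable (centered_normal 1) (\<lambda>x. (\<bar>a\<bar> + \<bar>b\<bar>)\<^sup>2 * x\<^sup>2)"
    using integrable_std_normal_moment[of 2]
    by (auto simp: centered_normal_def integrable_real_density)
  then show "integrable (centered_normal 1) (\<lambda>x. (kink a b x)\<^sup>2)"
  proof (rule Bochner_Integration.integrable_bound)
    have "(kink a b x)\<^sup>2 \<le> (\<bar>a\<bar> + \<bar>b\<bar>)\<^sup>2 * x\<^sup>2" for x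
      using power_mono[OF le[of x], of 2] by (simp add: power_mult_distrib)
    then show "AE x in centered_normal 1. norm ((kink a b x)\<^sup>2) \<le> norm ((\<bar>a\<bar> + \<bar>b\<bar>)\<^sup>2 * x\<^sup>2)"
      by (auto simp: abs_mult)
  qed auto
qed

abbreviation kink_variance :: "real \<Rightarrow> real \<Rightarrow> real" where
  "kink_variance a b \<equiv> prob_space.variance (centered_normal 1) (kink a b)"

text \<open>With variance zero the kink would be almost everywhere constant, but on the negative
  half-line it is injective when \<open>a\<close> is nonzero, so that half-line would be a null
  set.\<close>

lemma kink_variance_pos:
  assumes "a \<noteq> 0"
  shows "kink_variance a b > 0"
proof (rule ccontr)
  interpret prob_space "centered_normal 1"
    by (rule prob_space_centered_normal) simp
  define m where "m = expectation (kink a b)"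
  assume "\<not> kink_variance a b > 0"
  moreover have "kink_variance a b \<ge> 0" by simp
  ultimately have "(\<integral>x. (kink a b x - m)\<^sup>2 \<partial>centered_normal 1) = 0"
    by (simp add: m_def)
  moreover have "integrable (centered_normal 1) (\<lambda>x. (kink a b x - m)\<^sup>2)"
    using integrable_kink_normal[of a b] by (simp add: power2_diff)
  ultimately have "AE x in centered_normal 1. kink a b x = m"
    by (subst (asm) integral_nonneg_eq_0_iff_AE) auto
  then have "AE x in lborel. kink a b x = m"
    unfolding centered_normal_def
    by (subst (asm) AE_density) (auto simp: normal_density_pos)
  moreover have "AE x in lborel. x \<noteq> m / a"
    by (rule AE_lborel_singleton)
  ultimately have "AE x in lborel. x \<notin> {..<0::real}"
    by eventually_elim (use assms in \<open>auto simp: kink_def split: if_splits\<close>)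
  then have "{..<0::real} \<in> null_sets lborel"
    by (subst AE_iff_null_sets) auto
  then have "{-1<..<0::real} \<in> null_sets lborel"
    by (rule null_sets_subset) auto
  then have "emeasure lborel {-1<..<0::real} = 0"
    by (rule null_setsD1)
  then show False by simp
qed

text \<open>By positive homogeneity \<open>sqrt s\<close> comes out of the kink, and its square out
  of the variance.\<close>

lemma variance_kink_centered_normal:
  fixes a b :: real
  assumes "s > 0"
  defines "L \<equiv> distr (centered_normal s) borel (kink a b)"
  shows "integrable L (\<lambda>x. x\<^sup>2)" "prob_space.variance L (\<lambda>x. x) = s * kink_variance a b"
proof -
  have L: "L = distr (centered_normal 1) borel (\<lambda>x. sqrt s * kink a b x)"
    unfolding L_def centered_normal_scale[OF \<open>s > 0\<close>]
    by (subst distr_distr) (use \<open>s > 0\<close> in \<open>auto simp: comp_def kink_scale\<close>)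
  show "integrable L (\<lambda>x. x\<^sup>2)"
    unfolding L using integrable_kink_normal[of a b]
    by (subst integrable_distr_eq) (auto simp: power_mult_distrib)
  have "(sqrt s * x - sqrt s * y)\<^sup>2 = s * (x - y)\<^sup>2" for x y
    using \<open>s > 0\<close> by (simp add: right_diff_distrib[symmetric] power_mult_distrib)
  then show "prob_space.variance L (\<lambda>x. x) = s * kink_variance a b"
    unfolding L by (simp add: integral_distr)
qed

text \<open>The increment of \<open>J\<close> is the kink plus an error \<open>k x * (x - v)\<close>
  with \<open>k\<close> continuous and zero at \<open>v\<close>. Rescaled by \<open>sqrt n\<close>,
  the kink is unchanged and the error vanishes, so the mapping theorem applies to the rescaled
  increments.\<close>

lemma delta_method_kink:
  fixes J :: "real \<Rightarrow> real"
  assumes P: "prob_space P" and X: "\<And>n. X n \<in> borel_measurable P"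
    and conv: "converges_in_law P (\<lambda>n \<omega>. sqrt (real n) * (X n \<omega> - v)) (centered_normal s)"
    and s: "s > 0"
    and J: "J \<in> borel_measurable borel"
    and left: "(J has_real_derivative a) (at_left v)"
    and right: "(J has_real_derivative b) (at_right v)"
  shows "has_limiting_variance P (\<lambda>n \<omega>. sqrt (real n) * (J (X n \<omega>) - J v)) (s * kink_variance a b)"
proof -
  define r where "r x = (if x < v then a else b)" for x
  \<comment> \<open>The error of the difference quotient against the slope on the relevant side: a
    Caratheodory factor, two-sided despite the kink.\<close>
  define k where "k x = (if x = v then 0 else (J x - J v) / (x - v) - r x)" for x
  have Jk: "J x - J v = kink a b (x - v) + k x * (x - v)" for x
    by (auto simp: k_def r_def kink_def field_simps)
  have "(k \<longlongrightarrow> 0) (at_left v)"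
  proof (rule Lim_transform_eventually)
    show "((\<lambda>x. (J x - J v) / (x - v) - a) \<longlongrightarrow> 0) (at_left v)"
      using left by (simp add: has_field_derivative_iff LIM_zero_iff)
  qed (auto simp: eventually_at_filter k_def r_def)
  moreover have "(k \<longlongrightarrow> 0) (at_right v)"
  proof (rule Lim_transform_eventually)
    show "((\<lambda>x. (J x - J v) / (x - v) - b) \<longlongrightarrow> 0) (at_right v)"
      using right by (simp add: has_field_derivative_iff LIM_zero_iff)
  qed (auto simp: eventually_at_filter k_def r_def)
  ultimately have "(k \<longlongrightarrow> k v) (at v)"
    by (simp add: filterlim_at_split k_def)
  then have k: "isCont k v"
    by (simp add: isCont_def)
  \<comment> \<open>The scaled performance error as a function of the scaled estimation error
    \<open>x\<close>.\<close>
  define h where "h n x = sqrt (real n) * (J (v + x / sqrt (real n)) - J v)" for n :: nat and x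
  have [measurable]: "h n \<in> borel_measurable borel" for n
    unfolding h_def using J by measurable
  have lim: "(\<lambda>n. h n (y n)) \<longlonglongrightarrow> kink a b x" if y: "y \<longlonglongrightarrow> x" for y x
  proof -
    have "(\<lambda>n. inverse (sqrt (real n))) \<longlonglongrightarrow> 0"
      by (intro tendsto_inverse_0_at_top filterlim_compose[OF sqrt_at_top filterlim_real_sequentially])
    from tendsto_add[OF tendsto_const[of v] tendsto_mult[OF y this]]
    have "(\<lambda>n. v + y n / sqrt (real n)) \<longlonglongrightarrow> v"
      by (simp add: divide_inverse)
    then have "(\<lambda>n. k (v + y n / sqrt (real n))) \<longlonglongrightarrow> k v"
      by (rule isCont_tendsto_compose[OF k])
    then have "(\<lambda>n. kink a b (y n) + k (v + y n / sqrt (real n)) * y n) \<longlonglongrightarrow> kink a b x + k v * x"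
      by (intro tendsto_intros y isCont_tendsto_compose[OF isCont_kink])
    \<comment> \<open>Homogeneity needs a positive scale. At \<open>n = 0\<close> the right side is
      zero while the left side need not be, hence the restriction.\<close>
    moreover have "kink a b (y n) + k (v + y n / sqrt (real n)) * y n = h n (y n)" if "n > 0" for n
    proof -
      have "kink a b (y n) = sqrt (real n) * kink a b (y n / sqrt (real n))"
        using that by (subst kink_scale[symmetric]) auto
      then show ?thesis
        using that unfolding h_def Jk by (simp add: algebra_simps)
    qed
    then have "\<forall>\<^sub>F n in sequentially. kink a b (y n) + k (v + y n / sqrt (real n)) * y n = h n (y n)"
      using eventually_gt_at_top[of "0::nat"] by (rule eventually_mono[rotated]) blast
    ultimately show ?thesis
      by (auto simp: k_def intro: Lim_transform_eventually)
  qed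
  have "converges_in_law P (\<lambda>n \<omega>. h n (sqrt (real n) * (X n \<omega> - v))) (distr (centered_normal s) borel (kink a b))"
    by (rule converges_in_law_mapping[OF P _ conv]) (use X lim in auto)
  also have "(\<lambda>n \<omega>. h n (sqrt (real n) * (X n \<omega> - v))) = (\<lambda>n \<omega>. sqrt (real n) * (J (X n \<omega>) - J v))"
    by (auto simp: h_def fun_eq_iff)
  finally show ?thesis
    unfolding has_limiting_variance_def using variance_kink_centered_normal[OF s, of a b] by blast
qed

subsection \<open>Laws with a continuous density\<close>

text \<open>Cutting at \<open>u - 1\<close> leaves a constant plus an integral over a compact
  interval, to which the fundamental theorem of calculus applies.\<close>

lemma has_real_derivative_lower_tail_integral:
  fixes p :: "real \<Rightarrow> real"
  assumes int: "integrable lborel p" and cont: "continuous_on UNIV p"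
  shows "((\<lambda>u. LINT x:{..u}|lborel. p x) has_real_derivative p u) (at u)"
proof -
  define c where "c = u - 1"
  have si: "set_integrable lborel A p" if "A \<in> sets borel" for A
    unfolding set_integrable_def using that by (intro integrable_mult_indicator int) auto
  have eq: "(LINT x:{..w}|lborel. p x) = (LINT x:{..<c}|lborel. p x) + integral {c..w} p" if "c \<le> w" for w
  proof -
    have "{..w} = {..<c} \<union> {c..w}" using that by auto
    then have "(LINT x:{..w}|lborel. p x) = (LINT x:{..<c}|lborel. p x) + (LINT x:{c..w}|lborel. p x)"
      by (simp only:) (rule set_integral_Un, use si in auto)
    then show ?thesis
      using set_borel_integral_eq_integral(2)[OF si[of "{c..w}"]] by simp
  qed
  have "((\<lambda>w. integral {c..w} p) has_real_derivative p u) (at u within {c..u + 1})"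
    by (rule integral_has_real_derivative)
       (use cont in \<open>auto simp: c_def intro: continuous_on_subset\<close>)
  then have "((\<lambda>w. integral {c..w} p) has_real_derivative p u) (at u)"
    by (simp add: at_within_Icc_at c_def)
  then have "((\<lambda>w. (LINT x:{..<c}|lborel. p x) + integral {c..w} p) has_real_derivative p u) (at u)"
    by (auto intro!: derivative_eq_intros)
  then show ?thesis
  proof (rule has_field_derivative_transform_within_open[of _ _ _ "{c<..}"])
  qed (auto simp: eq c_def)
qed

locale continuous_law =
  fixes f :: "real \<Rightarrow> real"
  assumes nonneg: "0 \<le> f x" and cont: "continuous_on UNIV f" and prob: "prob_space (law f)"
begin

lemma f_measurable [measurable]: "f \<in> borel_measurable borel"
  using cont by (rule borel_measurable_continuous_onI)

lemma sets_law [simp, measurable_cong]: "sets (law f) = sets borel"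
  by (simp add: law_def)

lemma space_law [simp]: "space (law f) = UNIV"
  by (simp add: law_def)

sublocale real_distribution "law f"
  using prob by (simp add: real_distribution_def real_distribution_axioms_def)

lemma integral_law: "h \<in> borel_measurable borel \<Longrightarrow> (LINT x|law f. h x) = (LINT x|lborel. f x * h x)"
  for h :: "real \<Rightarrow> real"
  unfolding law_def by (subst integral_real_density) (auto simp: nonneg)

lemma integrable_law: "h \<in> borel_measurable borel \<Longrightarrow> integrable (law f) h \<longleftrightarrow> integrable lborel (\<lambda>x. f x * h x)"
  for h :: "real \<Rightarrow> real"
  unfolding law_def by (subst integrable_real_density) (auto simp: nonneg)

lemma AE_law: "(AE x in law f. Q x) \<longleftrightarrow> (AE x in lborel. 0 < f x \<longrightarrow> Q x)"
  unfolding law_def by (subst AE_density) (auto)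

lemma integrable_density: "integrable lborel f"
  using integrable_law[of "\<lambda>_. 1"] by simp

lemma set_lint_law:
  "A \<in> sets borel \<Longrightarrow> h \<in> borel_measurable borel \<Longrightarrow> (LINT x:A|law f. h x) = (LINT x:A|lborel. f x * h x)"
  for h :: "real \<Rightarrow> real"
  unfolding set_lebesgue_integral_def by (subst integral_law) (auto simp: ac_simps)

lemma measure_law: "A \<in> sets borel \<Longrightarrow> measure (law f) A = (LINT x:A|lborel. f x)"
  using set_lint_law[of A "\<lambda>_. 1"] by (simp add: set_lebesgue_integral_def)

lemma cdf_has_derivative: "(cdf (law f) has_real_derivative f x) (at x)"
  using has_real_derivative_lower_tail_integral[OF integrable_density cont, of x]
  by (simp add: cdf_def2[abs_def] measure_law)

lemma isCont_cdf_law: "isCont (cdf (law f)) x"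
  using cdf_has_derivative by (rule DERIV_isCont)

lemma measure_law_singleton: "measure (law f) {x} = 0"
  using isCont_cdf_law isCont_cdf by simp

lemma ccdf_eq_greaterThan: "ccdf f x = measure (law f) {x<..}"
proof -
  have "measure (law f) {x<..} = measure (law f) (space (law f) - {..x})"
    by (rule arg_cong[where f = "measure (law f)"]) auto
  also have "\<dots> = 1 - cdf (law f) x"
    by (subst prob_compl) (auto simp: cdf_def2)
  finally show ?thesis by (simp add: ccdf_def)
qed

lemma ccdf_eq_atLeast: "ccdf f x = measure (law f) {x..}"
proof -
  have "{x..} = {x} \<union> {x<..}" by auto
  then have "measure (law f) {x..} = measure (law f) {x} + measure (law f) {x<..}"
    by (simp only:) (rule finite_measure_Union, auto)
  then show ?thesis by (simp add: measure_law_singleton ccdf_eq_greaterThan)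
qed

end

section \<open>Strictly increasing distribution functions and their quantiles\<close>

locale strict_continuous_law = continuous_law +
  assumes mono: "strict_mono (cdf (law f))"
begin

lemma ccdf_less_iff [simp]: "ccdf f x < ccdf f y \<longleftrightarrow> y < x"
  using strict_mono_less[OF mono] by (simp add: ccdf_def)

lemma cdf_pos: "0 < cdf (law f) x"
  using cdf_nonneg[of "x - 1"] strict_monoD[OF mono, of "x - 1" x] by simp

lemma cdf_less_1: "cdf (law f) x < 1"
  using cdf_bounded_prob[of "x + 1"] strict_monoD[OF mono, of x "x + 1"] by simp

text \<open>\<open>inv\<close> only chooses a preimage, so the content is that \<open>r\<close> is
  attained, by the intermediate value theorem between the two tails.\<close>

lemma ccdf_inv:
  assumes "0 < r" "r < 1"
  shows "ccdf f (ccdf_inv f r) = r"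
proof -
  obtain a where a: "cdf (law f) a < 1 - r"
    using order_tendstoD(2)[OF cdf_lim_at_bot, of "1 - r"] assms
    by (auto dest!: eventually_happens'[OF trivial_limit_at_bot_linorder])
  obtain b where b: "cdf (law f) b > 1 - r"
    using order_tendstoD(1)[OF cdf_lim_at_top_prob, of "1 - r"] assms
    by (auto dest!: eventually_happens'[OF trivial_limit_at_top_linorder])
  have "a \<le> b"
    using a b strict_mono_less[OF mono, of a b] by linarith
  then obtain x where "cdf (law f) x = 1 - r"
    using IVT[of "cdf (law f)" a "1 - r" b] a b isCont_cdf_law by auto
  then have "ccdf f x = r"
    by (simp add: ccdf_def)
  then show ?thesis
    unfolding ccdf_inv_def by (metis f_inv_into_f rangeI)
qed

end

subsection \<open>Parameter derivatives and the information bound\<close>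

text \<open>The mean value inequality turns the bound on the derivative into the bound
  \<open>K\<close> on the difference quotients, and dominated convergence upgrades their pointwise
  convergence to convergence in L1.\<close>

lemma L1_derivative_exists:
  fixes g :: "real \<Rightarrow> real \<Rightarrow> real"
  assumes Theta: "open \<Theta>" "\<theta> \<in> \<Theta>"
    and meas: "\<And>t. t \<in> \<Theta> \<Longrightarrow> g t \<in> borel_measurable borel"
    and \<delta>: "\<delta> > 0" and K: "integrable lborel K"
    and diff: "AE x in lborel. \<forall>t\<in>\<Theta>. \<bar>t - \<theta>\<bar> < \<delta> \<longrightarrow>
         (\<lambda>s. g s x) differentiable (at t) \<and> \<bar>deriv (\<lambda>s. g s x) t\<bar> \<le> K x"
  obtains d where "integrable lborel d"
    "AE x in lborel. ((\<lambda>s. g s x) has_real_derivative d x) (at \<theta>)"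
    "((\<lambda>t. LINT x|lborel. \<bar>(g t x - g \<theta> x) / (t - \<theta>) - d x\<bar>) \<longlongrightarrow> 0) (at \<theta>)"
proof -
  obtain e0 where e0: "e0 > 0" "ball \<theta> e0 \<subseteq> \<Theta>"
    using Theta by (auto simp: open_contains_ball)
  define e where "e = min e0 \<delta>"
  have e: "e > 0" "ball \<theta> e \<subseteq> \<Theta>" "e \<le> \<delta>"
    using e0 \<delta> by (auto simp: e_def)
  have der: "AE x in lborel. \<forall>t\<in>ball \<theta> e.
      ((\<lambda>s. g s x) has_real_derivative deriv (\<lambda>s. g s x) t) (at t) \<and> \<bar>deriv (\<lambda>s. g s x) t\<bar> \<le> K x"
    using diff
  proof eventually_elim
    case (elim x)
    show ?case
    proof
      fix t assume "t \<in> ball \<theta> e"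
      then have "t \<in> \<Theta>" "\<bar>t - \<theta>\<bar> < \<delta>"
        using e by (auto simp: dist_real_def abs_minus_commute)
      then show "((\<lambda>s. g s x) has_real_derivative deriv (\<lambda>s. g s x) t) (at t) \<and> \<bar>deriv (\<lambda>s. g s x) t\<bar> \<le> K x"
        using elim by (simp add: DERIV_deriv_iff_real_differentiable)
    qed
  qed
  define \<Delta> where "\<Delta> t x = (g t x - g \<theta> x) / (t - \<theta>)" for t x
  have \<Delta>_meas: "\<Delta> t \<in> borel_measurable borel" if "t \<in> ball \<theta> e" for t
    unfolding \<Delta>_def using meas[of t] meas[of \<theta>] e Theta that by auto
  have \<Delta>_lim: "(\<lambda>n. \<Delta> (X n) x) \<longlonglongrightarrow> deriv (\<lambda>s. g s x) \<theta>"
    if "\<forall>t\<in>ball \<theta> e. ((\<lambda>s. g s x) has_real_derivative deriv (\<lambda>s. g s x) t) (at t) \<and> \<bar>deriv (\<lambda>s. g s x) t\<bar> \<le> K x"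
      and "\<And>n. X n \<noteq> \<theta>" "X \<longlonglongrightarrow> \<theta>" for X :: "nat \<Rightarrow> real" and x
  proof -
    have "((\<lambda>t. \<Delta> t x) \<longlongrightarrow> deriv (\<lambda>s. g s x) \<theta>) (at \<theta>)"
      using that(1) e(1) unfolding \<Delta>_def by (auto simp: has_field_derivative_iff)
    then show ?thesis
      using that(2,3) by (auto simp: tendsto_at_iff_sequentially comp_def)
  qed
  \<comment> \<open>A fixed sequence tending to the parameter inside the ball. As
    \<open>deriv\<close> is not known to be measurable in \<open>x\<close>, \<open>d\<close> is
    taken as the limit of the quotients along this sequence, which is measurable and almost
    everywhere equal to \<open>deriv\<close>.\<close>
  define X0 where "X0 n = \<theta> + e / 2 * inverse (real (Suc n))" for n
  have X0: "X0 n \<in> ball \<theta> e" "X0 n \<noteq> \<theta>" for n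
    using e(1) by (auto simp: X0_def dist_real_def field_simps add_pos_nonneg)
  have X0_lim: "X0 \<longlonglongrightarrow> \<theta>"
    unfolding X0_def
    using tendsto_add[OF tendsto_const tendsto_mult[OF tendsto_const LIMSEQ_inverse_real_of_nat], of \<theta> "e / 2"]
    by simp
  define d where "d x = lim (\<lambda>n. \<Delta> (X0 n) x)" for x
  have [measurable]: "d \<in> borel_measurable borel"
    unfolding d_def by (intro borel_measurable_lim_metric \<Delta>_meas X0)
  have d: "AE x in lborel. d x = deriv (\<lambda>s. g s x) \<theta>"
    using der
  proof eventually_elim
    case (elim x)
    show ?case
      unfolding d_def using \<Delta>_lim[OF elim X0(2) X0_lim] by (rule limI)
  qed
  have bd: "AE x in lborel. \<bar>d x\<bar> \<le> K x"
    using d der by eventually_elim (use e(1) in auto)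
  have int_d: "integrable lborel d"
    by (rule Bochner_Integration.integrable_bound[OF K]) (use bd in auto)
  have dd: "AE x in lborel. ((\<lambda>s. g s x) has_real_derivative d x) (at \<theta>)"
    using d der by eventually_elim (use e(1) in auto)
  have \<Delta>_le: "\<bar>\<Delta> t x\<bar> \<le> K x"
    if "\<forall>t\<in>ball \<theta> e. ((\<lambda>s. g s x) has_real_derivative deriv (\<lambda>s. g s x) t) (at t) \<and> \<bar>deriv (\<lambda>s. g s x) t\<bar> \<le> K x"
      and "t \<in> ball \<theta> e" "t \<noteq> \<theta>" for t x
  proof -
    have "norm (g t x - g \<theta> x) \<le> K x * norm (t - \<theta>)"
      by (rule field_differentiable_bound[of "ball \<theta> e" _ "deriv (\<lambda>s. g s x)"])
         (use that e(1) in \<open>auto intro: has_field_derivative_at_within\<close>)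
    then show ?thesis
      using that by (simp add: \<Delta>_def field_simps)
  qed
  \<comment> \<open>Restricting to the open ball leaves the limit unchanged but confines the test
    sequences to where the bounds hold.\<close>
  have "((\<lambda>t. LINT x|lborel. \<bar>\<Delta> t x - d x\<bar>) \<longlongrightarrow> 0) (at \<theta> within ball \<theta> e)"
    unfolding tendsto_at_iff_sequentially
  proof safe
    fix X :: "nat \<Rightarrow> real"
    assume "\<forall>i. X i \<in> ball \<theta> e - {\<theta>}" and XL: "X \<longlonglongrightarrow> \<theta>"
    then have X: "X i \<in> ball \<theta> e" "X i \<noteq> \<theta>" for i
      by auto
    have [measurable]: "\<Delta> (X i) \<in> borel_measurable borel" for i
      by (intro \<Delta>_meas X)
    have "(\<lambda>i. LINT x|lborel. \<bar>\<Delta> (X i) x - d x\<bar>) \<longlonglongrightarrow> (LINT x|(lborel :: real measure). 0)"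
    proof (rule integral_dominated_convergence[where w = "\<lambda>x. 2 * K x"])
      show "AE x in lborel. (\<lambda>i. \<bar>\<Delta> (X i) x - d x\<bar>) \<longlonglongrightarrow> 0"
        using d der
      proof eventually_elim
        case (elim x)
        from \<Delta>_lim[OF elim(2) X(2) XL] elim(1) show ?case
          by (intro tendsto_rabs_zero) (simp add: LIM_zero)
      qed
      show "AE x in lborel. norm \<bar>\<Delta> (X i) x - d x\<bar> \<le> 2 * K x" for i
        using bd der
      proof eventually_elim
        case (elim x)
        then show ?case using \<Delta>_le[OF elim(2) X[of i]] by simp
      qed
    qed (use K in auto)
    then show "((\<lambda>t. LINT x|lborel. \<bar>\<Delta> t x - d x\<bar>) \<circ> X) \<longlonglongrightarrow> 0"
      by (simp add: comp_def)
  qed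
  then have "((\<lambda>t. LINT x|lborel. \<bar>\<Delta> t x - d x\<bar>) \<longlongrightarrow> 0) (at \<theta>)"
    using e(1) by (subst (asm) at_within_open) auto
  with int_d dd show ?thesis
    unfolding \<Delta>_def by (rule that)
qed

text \<open>The indicators converge everywhere except possibly at \<open>v\<close>, a null set, and
  the integrands are dominated by \<open>\<bar>d x\<bar>\<close>.\<close>

lemma isCont_upper_tail_integral:
  fixes d :: "real \<Rightarrow> real"
  assumes d: "integrable lborel d"
  shows "isCont (\<lambda>u. LINT x:{u<..}|lborel. d x) v"
  unfolding isCont_def tendsto_at_iff_sequentially set_lebesgue_integral_def comp_def
proof safe
  fix X :: "nat \<Rightarrow> real" assume X: "X \<longlonglongrightarrow> v"
  have [measurable]: "d \<in> borel_measurable borel"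
    using d by auto
  show "(\<lambda>i. LINT x|lborel. indicat_real {X i<..} x *\<^sub>R d x) \<longlonglongrightarrow> (LINT x|lborel. indicat_real {v<..} x *\<^sub>R d x)"
  proof (rule integral_dominated_convergence[where w = "\<lambda>x. \<bar>d x\<bar>"])
    show "AE x in lborel. (\<lambda>i. indicat_real {X i<..} x *\<^sub>R d x) \<longlonglongrightarrow> indicat_real {v<..} x *\<^sub>R d x"
      using AE_lborel_singleton[of v]
    proof eventually_elim
      case (elim x)
      have "\<forall>\<^sub>F i in sequentially. indicat_real {v<..} x *\<^sub>R d x = indicat_real {X i<..} x *\<^sub>R d x"
      proof (cases "x < v")
        case True
        from order_tendstoD(1)[OF X this] show ?thesis
          by (rule eventually_mono) (use True in \<open>auto simp: indicator_def\<close>)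
      next
        case False
        with elim have "v < x" by simp
        from order_tendstoD(2)[OF X this] show ?thesis
          by (rule eventually_mono) (use \<open>v < x\<close> in \<open>auto simp: indicator_def\<close>)
      qed
      then show ?case
        by (rule Lim_transform_eventually[OF tendsto_const])
    qed
  qed (use d in \<open>auto simp: indicator_def\<close>)
qed

section \<open>Families of densities differentiable in L1 with respect to the parameter\<close>

locale L1_differentiable_family =
  fixes g :: "real \<Rightarrow> real \<Rightarrow> real" and \<Theta> :: "real set" and \<theta> :: real and d :: "real \<Rightarrow> real"
  assumes Theta: "open \<Theta>" "\<theta> \<in> \<Theta>"
    and family: "t \<in> \<Theta> \<Longrightarrow> strict_continuous_law (g t)"
    and integrable_d: "integrable lborel d"
    and L1_derivative: "((\<lambda>t. LINT x|lborel. \<bar>(g t x - g \<theta> x) / (t - \<theta>) - d x\<bar>) \<longlongrightarrow> 0) (at \<theta>)"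

sublocale L1_differentiable_family \<subseteq> strict_continuous_law "g \<theta>"
  by (rule family) (rule Theta)

context L1_differentiable_family
begin

lemma eventually_parameter: "\<forall>\<^sub>F t in at \<theta>. t \<in> \<Theta> \<and> t \<noteq> \<theta>"
  using eventually_at_in_open[OF Theta] by (auto elim: eventually_mono)

text \<open>The bound is the same for all events \<open>A\<close>, so it still applies when the
  event moves with \<open>t\<close>, as it does for a moving quantile.\<close>

lemma measure_difference_quotient:
  assumes t: "t \<in> \<Theta>" and A: "A \<in> sets borel"
  shows "\<bar>(measure (law (g t)) A - measure (law (g \<theta>)) A) / (t - \<theta>) - (LINT x:A|lborel. d x)\<bar>
    \<le> (LINT x|lborel. \<bar>(g t x - g \<theta> x) / (t - \<theta>) - d x\<bar>)"
proof -
  interpret t: strict_continuous_law "g t" by (rule family) fact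
  let ?D = "\<lambda>x. (g t x - g \<theta> x) / (t - \<theta>) - d x"
  have int: "integrable lborel ?D"
    using t.integrable_density integrable_density integrable_d by auto
  have si: "set_integrable lborel A h" if "integrable lborel h" for h :: "real \<Rightarrow> real"
    unfolding set_integrable_def using that A by (intro integrable_mult_indicator) auto
  have "(measure (law (g t)) A - measure (law (g \<theta>)) A) / (t - \<theta>) - (LINT x:A|lborel. d x) = (LINT x:A|lborel. ?D x)"
    using si[OF t.integrable_density] si[OF integrable_density] si[OF integrable_d]
    by (simp add: t.measure_law measure_law A set_integral_diff)
  also have "\<bar>\<dots>\<bar> \<le> (LINT x:A|lborel. \<bar>?D x\<bar>)"
    using set_integral_norm_bound[OF si[OF int]] by simp
  also have "\<dots> \<le> (LINT x|lborel. \<bar>?D x\<bar>)"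
    unfolding set_lebesgue_integral_def
    by (rule integral_mono[OF integrable_mult_indicator])
       (use int A in \<open>auto split: split_indicator\<close>)
  finally show ?thesis .
qed

lemma measure_has_derivative:
  assumes A: "A \<in> sets borel"
  shows "((\<lambda>t. measure (law (g t)) A) has_real_derivative (LINT x:A|lborel. d x)) (at \<theta>)"
proof -
  let ?Q = "\<lambda>t. (measure (law (g t)) A - measure (law (g \<theta>)) A) / (t - \<theta>)"
  have "((\<lambda>t. ?Q t - (LINT x:A|lborel. d x)) \<longlongrightarrow> 0) (at \<theta>)"
    by (rule Lim_null_comparison[OF _ L1_derivative])
       (use eventually_parameter in \<open>eventually_elim, use measure_difference_quotient A in auto\<close>)
  then show ?thesis
    by (simp add: has_field_derivative_iff LIM_zero_iff)
qed

text \<open>The total mass is 1 throughout \<open>\<Theta>\<close>, so its parameter derivative is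
  zero.\<close>

lemma integral_d: "(LINT x|lborel. d x) = 0"
proof -
  have "((\<lambda>t. measure (law (g t)) UNIV) has_real_derivative (LINT x|lborel. d x)) (at \<theta>)"
    using measure_has_derivative[of UNIV] by (simp add: set_lebesgue_integral_def)
  moreover have "((\<lambda>t. measure (law (g t)) UNIV) has_real_derivative 0) (at \<theta>)"
  proof (rule has_field_derivative_transform_within_open[OF DERIV_const[of 1] Theta])
    fix t assume "t \<in> \<Theta>"
    then interpret t: strict_continuous_law "g t" by (rule family)
    show "1 = measure (law (g t)) UNIV"
      using t.prob_space by simp
  qed
  ultimately show ?thesis by (rule DERIV_unique)
qed

lemma ccdf_has_parameter_derivative:
  "((\<lambda>t. ccdf (g t) x) has_real_derivative (LINT y:{x<..}|lborel. d y)) (at \<theta>)"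
proof (rule has_field_derivative_transform_within_open[OF measure_has_derivative Theta])
  fix t assume "t \<in> \<Theta>"
  then interpret t: strict_continuous_law "g t" by (rule family)
  show "measure (law (g t)) {x<..} = ccdf (g t) x"
    by (simp add: t.ccdf_eq_greaterThan)
qed auto

text \<open>Comparing the quantile with \<open>a\<close> amounts to comparing the tail probability
  at \<open>a\<close> with \<open>r\<close>, and the latter is continuous in the parameter for fixed
  \<open>a\<close>.\<close>

lemma quantile_tendsto:
  assumes r: "0 < r" "r < 1"
  shows "((\<lambda>t. ccdf_inv (g t) r) \<longlongrightarrow> ccdf_inv (g \<theta>) r) (at \<theta>)"
proof (rule order_tendstoI)
  have lim: "((\<lambda>t. ccdf (g t) a) \<longlongrightarrow> ccdf (g \<theta>) a) (at \<theta>)" for a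
    using DERIV_isCont[OF ccdf_has_parameter_derivative, of a] by (simp add: isCont_def)
  have less: "ccdf (g t) a < ccdf (g t) (ccdf_inv (g t) r) \<longleftrightarrow> ccdf_inv (g t) r < a"
    "ccdf (g t) (ccdf_inv (g t) r) < ccdf (g t) a \<longleftrightarrow> a < ccdf_inv (g t) r"
    "ccdf (g t) (ccdf_inv (g t) r) = r" if "t \<in> \<Theta>" for t a
  proof -
    interpret t: strict_continuous_law "g t" by (rule family) fact
    show "ccdf (g t) a < ccdf (g t) (ccdf_inv (g t) r) \<longleftrightarrow> ccdf_inv (g t) r < a"
      "ccdf (g t) (ccdf_inv (g t) r) < ccdf (g t) a \<longleftrightarrow> a < ccdf_inv (g t) r"
      "ccdf (g t) (ccdf_inv (g t) r) = r"
      by (rule t.ccdf_less_iff t.ccdf_inv[OF r])+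
  qed
  {
    fix a assume "a < ccdf_inv (g \<theta>) r"
    then have "r < ccdf (g \<theta>) a"
      using less(2,3)[OF Theta(2)] by metis
    from order_tendstoD(1)[OF lim this] eventually_parameter
    show "\<forall>\<^sub>F t in at \<theta>. a < ccdf_inv (g t) r"
      by eventually_elim (use less(2,3) in metis)
  next
    fix a assume "ccdf_inv (g \<theta>) r < a"
    then have "ccdf (g \<theta>) a < r"
      using less(1,3)[OF Theta(2)] by metis
    from order_tendstoD(2)[OF lim this] eventually_parameter
    show "\<forall>\<^sub>F t in at \<theta>. ccdf_inv (g t) r < a"
      by eventually_elim (use less(1,3) in metis)
  }
qed

text \<open>The tail probability at the quantile stays equal to \<open>r\<close>, so its change
  through the parameter balances its change through the threshold. Dividing the first rate by the
  slope of the tail probability gives the derivative.\<close>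

lemma quantile_has_derivative:
  assumes r: "0 < r" "r < 1"
  defines "v \<equiv> ccdf_inv (g \<theta>) r"
  assumes pos: "g \<theta> v > 0"
  shows "((\<lambda>t. ccdf_inv (g t) r) has_real_derivative (LINT x:{v<..}|lborel. d x) / g \<theta> v) (at \<theta>)"
proof -
  let ?w = "\<lambda>t. ccdf_inv (g t) r"
  let ?S = "\<lambda>u. LINT x:{u<..}|lborel. d x"
  let ?Q = "\<lambda>t. (ccdf (g t) (?w t) - ccdf (g \<theta>) (?w t)) / (t - \<theta>)"
  have w: "(?w \<longlongrightarrow> v) (at \<theta>)"
    unfolding v_def by (rule quantile_tendsto) fact+
  have "(ccdf (g \<theta>) has_real_derivative - g \<theta> v) (at v)"
    unfolding ccdf_def[abs_def] by (auto intro!: derivative_eq_intros cdf_has_derivative)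
  \<comment> \<open>The Caratheodory factor avoids division by \<open>?w t - v\<close>, which may
    vanish; \<open>h\<close> itself stays away from zero near \<open>v\<close>.\<close>
  then obtain h where h: "\<And>x. ccdf (g \<theta>) x - ccdf (g \<theta>) v = h x * (x - v)" "isCont h v" "h v = - g \<theta> v"
    unfolding CARAT_DERIV by blast
  have hw: "((\<lambda>t. h (?w t)) \<longlongrightarrow> - g \<theta> v) (at \<theta>)"
    using isCont_tendsto_compose[OF h(2) w] h(3) by simp
  \<comment> \<open>The threshold moves with \<open>t\<close>, which the bound uniform over events
    permits.\<close>
  have "((\<lambda>t. ?Q t - ?S (?w t)) \<longlongrightarrow> 0) (at \<theta>)"
  proof (rule Lim_null_comparison[OF _ L1_derivative], use eventually_parameter in eventually_elim)
    case (elim t)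
    then interpret t: strict_continuous_law "g t" using family by blast
    show ?case
      using measure_difference_quotient[of t "{?w t<..}"] elim
      by (simp add: t.ccdf_eq_greaterThan ccdf_eq_greaterThan)
  qed
  from tendsto_add[OF this isCont_tendsto_compose[OF isCont_upper_tail_integral[OF integrable_d] w]]
  have Q: "(?Q \<longlongrightarrow> ?S v) (at \<theta>)" by simp
  have "((\<lambda>t. - ?Q t / h (?w t)) \<longlongrightarrow> - ?S v / (- g \<theta> v)) (at \<theta>)"
    using pos by (intro tendsto_intros Q hw) auto
  moreover have "\<forall>\<^sub>F t in at \<theta>. h (?w t) \<noteq> 0"
    using tendsto_imp_eventually_ne[OF hw] pos by auto
  then have "\<forall>\<^sub>F t in at \<theta>. - ?Q t / h (?w t) = (?w t - v) / (t - \<theta>)"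
    using eventually_parameter
  proof eventually_elim
    case (elim t)
    then interpret t: strict_continuous_law "g t" using family by blast
    have "ccdf (g \<theta>) (?w t) - ccdf (g t) (?w t) = h (?w t) * (?w t - v)"
      using h(1)[of "?w t"] t.ccdf_inv[OF r] ccdf_inv[OF r] by (simp add: v_def)
    then have "- ?Q t = h (?w t) * (?w t - v) / (t - \<theta>)"
      by (simp add: minus_divide_left)
    then show ?case
      using elim by simp
  qed
  ultimately show ?thesis
    unfolding has_field_derivative_iff v_def[symmetric] by (auto intro: Lim_transform_eventually)
qed

text \<open>
  Since \<open>d\<close> integrates to zero, \<open>\<partial>ccdf/\<partial>\<theta>\<close> is the covariance of the score with the indicator of
  \<open>{x<..}\<close>; the bound is Cauchy-Schwarz, as the discriminant of a nonnegative quadratic.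
\<close>
lemma fisher_info_lower_bound:
  assumes nonneg_family: "\<And>t x. t \<in> \<Theta> \<Longrightarrow> 0 \<le> g t x"
    and d: "AE x in lborel. ((\<lambda>s. g s x) has_real_derivative d x) (at \<theta>)"
    and info: "integrable (law (g \<theta>)) (\<lambda>x. (deriv (\<lambda>t. ln (g t x)) \<theta>)\<^sup>2)"
    and r: "ccdf (g \<theta>) x = r" "0 < r" "r < 1"
    and D: "D = (LINT y:{x<..}|lborel. d y)"
  shows "D\<^sup>2 \<le> r * (1 - r) * fisher_info g \<theta>"
proof -
  have [measurable]: "d \<in> borel_measurable borel"
    using integrable_d by auto
  \<comment> \<open>The score where the density is positive; at zeros of the density, division by
    zero makes it 0.\<close>
  define s where "s y = d y / g \<theta> y" for y
  have [measurable]: "s \<in> borel_measurable borel"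
    unfolding s_def by measurable
  have score: "AE y in law (g \<theta>). (deriv (\<lambda>t. ln (g t y)) \<theta>)\<^sup>2 = (s y)\<^sup>2"
    unfolding AE_law using d
  proof eventually_elim
    case (elim y)
    show ?case
    proof
      assume "0 < g \<theta> y"
      then have "((\<lambda>t. ln (g t y)) has_real_derivative s y) (at \<theta>)"
        unfolding s_def using elim by (auto intro!: derivative_eq_intros simp: field_simps)
      then show "(deriv (\<lambda>t. ln (g t y)) \<theta>)\<^sup>2 = (s y)\<^sup>2"
        by (simp add: DERIV_imp_deriv)
    qed
  qed
  have s2: "integrable (law (g \<theta>)) (\<lambda>y. (s y)\<^sup>2)"
    by (rule integrable_cong_AE_imp[OF info]) (use score in \<open>auto\<close>)
  have I: "fisher_info g \<theta> = expectation (\<lambda>y. (s y)\<^sup>2)"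
    unfolding fisher_info_def by (rule integral_cong_AE) (use score info in auto)
  have gs: "AE y in lborel. g \<theta> y * s y = d y"
    using d
  proof eventually_elim
    case (elim y)
    \<comment> \<open>a zero of the density is a minimum in the parameter, so the derivative vanishes there\<close>
    have "d y = 0" if "g \<theta> y = 0"
    proof -
      obtain e where "e > 0" "ball \<theta> e \<subseteq> \<Theta>"
        using Theta by (auto simp: open_contains_ball)
      then have "\<forall>t. \<bar>\<theta> - t\<bar> < e \<longrightarrow> g \<theta> y \<le> g t y"
        using nonneg_family that by (auto simp: subset_iff dist_real_def)
      with \<open>e > 0\<close> show ?thesis
        by (intro DERIV_local_min[OF elim])
    qed
    then show ?case by (auto simp: s_def)
  qed
  \<comment> \<open>The centred indicator, with variance \<open>r * (1 - r)\<close>. Centring leaves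
    the pairing with \<open>d\<close> unchanged because \<open>d\<close> integrates to zero.\<close>
  define X where "X y = indicator {x<..} y - r" for y
  have [measurable]: "X \<in> borel_measurable borel"
    unfolding X_def[abs_def] by measurable
  have X2: "(X y)\<^sup>2 = (1 - 2 * r) * indicator {x<..} y + r\<^sup>2" for y
    by (auto simp: X_def indicator_def power2_eq_square algebra_simps)
  have X2_int: "integrable (law (g \<theta>)) (\<lambda>y. (X y)\<^sup>2)"
    unfolding X2 by (auto intro!: integrable_real_indicator simp: emeasure_eq_measure)
  have EX2: "expectation (\<lambda>y. (X y)\<^sup>2) = r * (1 - r)"
    unfolding X2 using r(1) prob_space
    by (simp add: emeasure_eq_measure ccdf_eq_greaterThan power2_eq_square algebra_simps)
  have dX: "integrable lborel (\<lambda>y. d y * X y)" "(LINT y|lborel. d y * X y) = D"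
  proof -
    have *: "integrable lborel (\<lambda>y. indicator {x<..} y *\<^sub>R d y)"
      by (intro integrable_mult_indicator integrable_d) auto
    have eq: "d y * X y = indicator {x<..} y *\<^sub>R d y - r * d y" for y
      by (simp add: X_def algebra_simps)
    show "integrable lborel (\<lambda>y. d y * X y)"
      unfolding eq using * integrable_d by auto
    show "(LINT y|lborel. d y * X y) = D"
      unfolding eq using * integrable_d by (simp add: integral_d D set_lebesgue_integral_def)
  qed
  have gsX: "AE y in lborel. d y * X y = g \<theta> y * (s y * X y)"
    using gs by eventually_elim (simp flip: mult.assoc)
  have sX_int: "integrable (law (g \<theta>)) (\<lambda>y. s y * X y)"
    unfolding integrable_law[of "\<lambda>y. s y * X y", simplified]
    by (rule integrable_cong_AE_imp[OF dX(1)]) (use gsX in auto)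
  have EsX: "expectation (\<lambda>y. s y * X y) = D"
  proof -
    have "expectation (\<lambda>y. s y * X y) = (LINT y|lborel. g \<theta> y * (s y * X y))"
      by (rule integral_law) simp
    also have "\<dots> = (LINT y|lborel. d y * X y)"
      using gsX by (intro integral_cong_AE) auto
    finally show ?thesis using dX(2) by simp
  qed
  have quad: "0 \<le> c\<^sup>2 * fisher_info g \<theta> - 2 * c * D + r * (1 - r)" for c
  proof -
    have "0 \<le> expectation (\<lambda>y. (c * s y - X y)\<^sup>2)"
      by simp
    also have "(\<lambda>y. (c * s y - X y)\<^sup>2) = (\<lambda>y. c\<^sup>2 * (s y)\<^sup>2 - 2 * c * (s y * X y) + (X y)\<^sup>2)"
      by (auto simp: fun_eq_iff power2_eq_square algebra_simps)
    also have "expectation \<dots> = c\<^sup>2 * fisher_info g \<theta> - 2 * c * D + r * (1 - r)"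
      using s2 sX_int X2_int by (simp add: I EsX EX2)
    finally show ?thesis .
  qed
  show ?thesis
  proof (cases "D = 0")
    case True
    then show ?thesis using r by (simp add: I)
  next
    case False
    \<comment> \<open>At \<open>c = V / D\<close> the quadratic equals
      \<open>V * (V * fisher_info g \<theta> - D\<^sup>2) / D\<^sup>2\<close>. This divides by
      \<open>D\<close>, nonzero here, rather than by the information, whose positivity is not yet
      established.\<close>
    define V where "V = r * (1 - r)"
    have "V > 0" using r by (simp add: V_def)
    have "0 \<le> V * (V * fisher_info g \<theta> - D\<^sup>2) / D\<^sup>2"
      using quad[of "V / D"] False
      by (simp add: V_def[symmetric] field_simps power2_eq_square)
    then have "0 \<le> V * fisher_info g \<theta> - D\<^sup>2"
      using False \<open>V > 0\<close> by (simp add: zero_le_divide_iff zero_le_mult_iff)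
    then show ?thesis by (simp add: V_def)
  qed
qed

end

subsection \<open>The performance function\<close>

text \<open>Expresses both conditional means through the single lower partial expectation
  \<open>H\<close>, whose derivative is known.\<close>

lemma (in strict_continuous_law) cond_mean_formulas:
  assumes mean: "integrable (law f) (\<lambda>x. x)"
  defines "H \<equiv> \<lambda>w. LINT x:{..w}|lborel. f x * x"
  shows "cond_mean (law f) {w..} = (expectation (\<lambda>x. x) - H w) / ccdf f w"
    and "cond_mean (law f) {..w} = H w / (1 - ccdf f w)"
proof -
  have int: "integrable lborel (\<lambda>x. f x * x)"
    using mean by (simp add: integrable_law)
  have si: "set_integrable lborel A (\<lambda>x. f x * x)" if "A \<in> sets borel" for A
    unfolding set_integrable_def using that by (intro integrable_mult_indicator int) auto
  have "(LINT x:{..w}|lborel. f x * x) + (LINT x:{w<..}|lborel. f x * x) = (LINT x:{..w} \<union> {w<..}|lborel. f x * x)"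
    by (rule set_integral_Un[symmetric]) (use si in auto)
  also have "{..w} \<union> {w<..} = UNIV" by auto
  finally have "H w + (LINT x:{w<..}|lborel. f x * x) = expectation (\<lambda>x. x)"
    by (simp add: H_def integral_law set_lebesgue_integral_def)
  \<comment> \<open>The two rays differ by one point, a null set.\<close>
  moreover have "(LINT x:{w..}|lborel. f x * x) = (LINT x:{w<..}|lborel. f x * x)"
    unfolding set_lebesgue_integral_def
    by (rule integral_cong_AE)
       (auto intro!: AE_mp[OF AE_lborel_singleton[of w] AE_I2] simp: indicator_def)
  ultimately show "cond_mean (law f) {w..} = (expectation (\<lambda>x. x) - H w) / ccdf f w"
    by (simp add: cond_mean_def set_lint_law ccdf_eq_atLeast)
  show "cond_mean (law f) {..w} = H w / (1 - ccdf f w)"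
    by (simp add: cond_mean_def set_lint_law H_def ccdf_def cdf_def2)
qed

text \<open>The difference of the two sides is the expectation of the positive part of
  \<open>x - v\<close>, which is positive because the tail beyond \<open>v\<close> has positive
  probability.\<close>

lemma (in strict_continuous_law) upper_tail_mean_greater:
  assumes mean: "integrable (law f) (\<lambda>x. x)"
  shows "v * ccdf f v < expectation (\<lambda>x. x) - (LINT x:{..v}|lborel. f x * x)"
proof -
  define Y where "Y x = indicator {v<..} x * (x - v)" for x :: real
  have int: "integrable lborel (\<lambda>x. f x * x)"
    using mean by (simp add: integrable_law)
  have ind: "integrable (law f) (\<lambda>x. indicator A x * x)" if "A \<in> sets borel" for A
    using integrable_mult_indicator[OF _ mean, of A] that by simp
  have Y: "Y x = x - indicator {..v} x * x - v * indicator {v<..} x" for x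
    by (auto simp: Y_def indicator_def)
  have int_Y: "integrable (law f) Y"
    unfolding Y[abs_def] using mean ind[of "{..v}"]
    by (auto intro!: integrable_real_indicator simp: emeasure_eq_measure)
  have lower: "(LINT x:{..v}|lborel. f x * x) = expectation (\<lambda>x. indicator {..v} x * x)"
    using set_lint_law[of "{..v}" "\<lambda>x. x"] by (simp add: set_lebesgue_integral_def)
  have EY: "expectation Y = expectation (\<lambda>x. x) - (LINT x:{..v}|lborel. f x * x) - v * ccdf f v"
    unfolding Y[abs_def] lower using mean ind[of "{..v}"]
    by (simp add: emeasure_eq_measure ccdf_eq_greaterThan)
  have nn: "0 \<le> Y x" for x
    by (auto simp: Y_def indicator_def)
  have "expectation Y \<noteq> 0"
  proof
    assume "expectation Y = 0"
    then have "AE x in law f. Y x = 0"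
      using integral_nonneg_eq_0_iff_AE[OF int_Y] nn by auto
    then have "AE x in law f. x \<notin> {v<..}"
      by eventually_elim (auto simp: Y_def)
    then have "measure (law f) {v<..} = 0"
      by (subst (asm) AE_iff_measurable[OF _ refl]) (auto simp: emeasure_eq_measure greaterThan_def)
    then show False
      using cdf_less_1[of v] ccdf_eq_greaterThan[of v] by (simp add: ccdf_def)
  qed
  moreover have "0 \<le> expectation Y"
    using nn by simp
  ultimately show ?thesis
    using EY by linarith
qed

text \<open>Both branches are differentiable at \<open>v\<close> and agree there, so the one-sided
  derivatives are those of the branches. The sign of \<open>a\<close> later keeps the variance of
  the kink positive.\<close>

lemma (in strict_continuous_law) Jbar_one_sided_derivatives:
  assumes r: "0 < r" "r < 1" and mean: "integrable (law f) (\<lambda>x. x)"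
  defines "v \<equiv> ccdf_inv f r"
  assumes pos: "f v > 0"
  obtains a b where "a > 0" "Jbar f r \<in> borel_measurable borel"
    "(Jbar f r has_real_derivative a) (at_left v)"
    "(Jbar f r has_real_derivative b) (at_right v)"
proof -
  define m where "m = expectation (\<lambda>x. x)"
  define H where "H w = (LINT x:{..w}|lborel. f x * x)" for w
  define Jl where "Jl w = r * ((m - H w) / ccdf f w)" for w
  define Jr where "Jr w = m - (1 - r) * (H w / (1 - ccdf f w))" for w
  have J: "Jbar f r w = (if w < v then Jl w else Jr w)" for w
    by (simp add: Jbar_def Jl_def Jr_def v_def cond_mean_formulas[OF mean] m_def H_def)
  have v: "ccdf f v = r"
    unfolding v_def by (rule ccdf_inv) fact+
  have dH: "(H has_real_derivative f w * w) (at w)" for w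
    unfolding H_def
    by (rule has_real_derivative_lower_tail_integral)
       (use mean cont in \<open>auto simp: integrable_law intro!: continuous_intros\<close>)
  have dG: "(ccdf f has_real_derivative - f w) (at w)" for w
    unfolding ccdf_def[abs_def] by (auto intro!: derivative_eq_intros cdf_has_derivative)
  have G: "0 < ccdf f w" "ccdf f w < 1" for w
    using cdf_pos[of w] cdf_less_1[of w] by (auto simp: ccdf_def)
  have [measurable]: "H \<in> borel_measurable borel" "ccdf f \<in> borel_measurable borel"
    using dH dG by (auto intro!: borel_measurable_continuous_onI continuous_at_imp_continuous_on DERIV_isCont)
  have meas: "Jbar f r \<in> borel_measurable borel"
    unfolding J[abs_def] Jl_def Jr_def by measurable
  \<comment> \<open>The density at \<open>v\<close> times the excess over \<open>v\<close> of the
    mean quality above \<open>v\<close>; for \<open>b\<close>, of the mean quality below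
    \<open>v\<close>.\<close>
  define a where "a = f v * ((m - H v) / r - v)"
  define b where "b = f v * (H v / (1 - r) - v)"
  have dl: "(Jl has_real_derivative a) (at v)"
    unfolding Jl_def a_def using r v
    by (auto intro!: derivative_eq_intros dH dG simp: field_simps power2_eq_square)
  have dr: "(Jr has_real_derivative b) (at v)"
  proof -
    define k where "k = 1 - r"
    have k: "k \<noteq> 0" "1 - ccdf f v = k" using r v by (auto simp: k_def)
    have "((\<lambda>w. 1 - ccdf f w) has_real_derivative f v) (at v)"
      by (auto intro!: derivative_eq_intros dG)
    from DERIV_divide[OF dH this] k
    have "((\<lambda>w. H w / (1 - ccdf f w)) has_real_derivative (f v * v * k - H v * f v) / (k * k)) (at v)"
      by simp
    from DERIV_diff[OF DERIV_const DERIV_cmult[OF this]]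
    have "(Jr has_real_derivative 0 - k * ((f v * v * k - H v * f v) / (k * k))) (at v)"
      unfolding Jr_def k_def .
    also have "0 - k * ((f v * v * k - H v * f v) / (k * k)) = b"
      using k unfolding b_def k_def[symmetric] by (simp add: field_simps)
    finally show ?thesis .
  qed
  \<comment> \<open>\<open>Jbar\<close> takes the right branch at \<open>v\<close>, so the left
    difference quotient needs this agreement.\<close>
  have eq: "Jl v = Jr v"
    using r v by (simp add: Jl_def Jr_def)
  have "(Jbar f r has_real_derivative a) (at_left v)"
    unfolding has_field_derivative_iff
  proof (rule Lim_transform_eventually)
    show "((\<lambda>x. (Jl x - Jl v) / (x - v)) \<longlongrightarrow> a) (at_left v)"
      using has_field_derivative_at_within[OF dl] by (simp add: has_field_derivative_iff)
  qed (auto simp: eventually_at_filter J eq)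
  moreover have "(Jbar f r has_real_derivative b) (at_right v)"
    unfolding has_field_derivative_iff
  proof (rule Lim_transform_eventually)
    show "((\<lambda>x. (Jr x - Jr v) / (x - v)) \<longlongrightarrow> b) (at_right v)"
      using has_field_derivative_at_within[OF dr] by (simp add: has_field_derivative_iff)
  qed (auto simp: eventually_at_filter J)
  moreover have "v < (m - H v) / r"
    using upper_tail_mean_greater[OF mean, of v] r v
    by (simp add: m_def H_def field_simps)
  then have "a > 0"
    using pos by (simp add: a_def)
  ultimately show ?thesis
    using that meas by blast
qed

text \<open>The limit laws of both estimators are hypotheses, as part of the assumed regularity.
  \<open>nondeg\<close> makes the parametric limiting variance positive, so both efficiencies are
  genuine quotients.\<close>

theorem proposition8:
  fixes g :: "real \<Rightarrow> real \<Rightarrow> real" and \<Theta> :: "real set" and \<theta> \<rho> v :: real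
    and P :: "'a measure" and q :: "nat \<Rightarrow> 'a \<Rightarrow> real"
    and vhat thetahat vmle :: "nat \<Rightarrow> 'a \<Rightarrow> real"
    and \<delta> :: real and K :: "real \<Rightarrow> real"
  assumes rho: "0 < \<rho>" "\<rho> < 1"
    and Theta: "open \<Theta>" "\<theta> \<in> \<Theta>"
    and dens_nonneg: "\<And>t x. t \<in> \<Theta> \<Longrightarrow> 0 \<le> g t x"
    and dens_cont: "\<And>t. t \<in> \<Theta> \<Longrightarrow> continuous_on UNIV (g t)"
    and dens_prob: "\<And>t. t \<in> \<Theta> \<Longrightarrow> prob_space (law (g t))"
    and cdf_mono: "\<And>t. t \<in> \<Theta> \<Longrightarrow> strict_mono (cdf (law (g t)))"
    and mean: "integrable (law (g \<theta>)) (\<lambda>x. x)"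
    and v: "v = ccdf_inv (g \<theta>) \<rho>"
    \<comment> \<open>regularity of the family at the true parameter\<close>
    and dens_diff: "\<delta> > 0" "integrable lborel K"
      "AE x in lborel. \<forall>t\<in>\<Theta>. \<bar>t - \<theta>\<bar> < \<delta> \<longrightarrow>
         (\<lambda>s. g s x) differentiable (at t) \<and> \<bar>deriv (\<lambda>s. g s x) t\<bar> \<le> K x"
    and info_finite: "integrable (law (g \<theta>)) (\<lambda>x. (deriv (\<lambda>t. ln (g t x)) \<theta>)\<^sup>2)"
    and dens_pos: "g \<theta> v > 0"
    and nondeg: "deriv (\<lambda>t. ccdf (g t) v) \<theta> \<noteq> 0"
    \<comment> \<open>i.i.d. sample\<close>
    and P: "prob_space P"
    and indep: "prob_space.indep_vars P (\<lambda>_. borel) q UNIV"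
    and ident: "\<And>m. distributed P lborel (q m) (\<lambda>x. ennreal (g \<theta> x))"
    \<comment> \<open>parametric estimator\<close>
    and mle_meas: "\<And>M. thetahat M \<in> borel_measurable P" "\<And>M. vmle M \<in> borel_measurable P"
    and mle: "\<And>M. M > 0 \<Longrightarrow> AE \<omega> in P.
      is_arg_max (log_likelihood g M (\<lambda>m. q m \<omega>)) (\<lambda>t. t \<in> \<Theta>) (thetahat M \<omega>)"
    and vmle: "\<And>M \<omega>. vmle M \<omega> = ccdf_inv (g (thetahat M \<omega>)) \<rho>"
    and mle_normal: "converges_in_law P (\<lambda>M \<omega>. sqrt (real M) * (vmle M \<omega> - v))
      (centered_normal (avar_mle g \<rho> \<theta>))"
    \<comment> \<open>non-parametric estimator\<close>
    and np_meas: "\<And>M. vhat M \<in> borel_measurable P"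
    and np: "\<And>M. M > 0 \<Longrightarrow> AE \<omega> in P.
      is_arg_min (empirical_objective \<rho> M (\<lambda>m. q m \<omega>)) (\<lambda>w. True) (vhat M \<omega>)"
    and np_normal: "converges_in_law P (\<lambda>M \<omega>. sqrt (real M) * (vhat M \<omega> - v))
      (centered_normal (avar_np g \<rho> \<theta>))"
  shows "rel_efficiency g \<rho> \<theta> =
           \<rho> * (1 - \<rho>) * fisher_info g \<theta> / (deriv (\<lambda>t. ccdf (g t) v) \<theta>)\<^sup>2
       \<and> rel_efficiency g \<rho> \<theta> \<ge> 1
       \<and> (\<exists>s' s.
             has_limiting_variance P
               (\<lambda>M \<omega>. sqrt (real M) * (Jbar (g \<theta>) \<rho> (vhat M \<omega>) - Jbar (g \<theta>) \<rho> v)) s'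
           \<and> has_limiting_variance P
               (\<lambda>M \<omega>. sqrt (real M) * (Jbar (g \<theta>) \<rho> (vmle M \<omega>) - Jbar (g \<theta>) \<rho> v)) s
           \<and> s > 0
           \<and> rel_efficiency g \<rho> \<theta> = s' / s)"
proof -
  have family: "strict_continuous_law (g t)" if "t \<in> \<Theta>" for t
    using that dens_nonneg dens_cont dens_prob cdf_mono
    by (simp add: strict_continuous_law_def continuous_law_def strict_continuous_law_axioms_def)
  have meas: "g t \<in> borel_measurable borel" if "t \<in> \<Theta>" for t
    using dens_cont[OF that] by (rule borel_measurable_continuous_onI)
  obtain d where d: "integrable lborel d"
    "AE x in lborel. ((\<lambda>s. g s x) has_real_derivative d x) (at \<theta>)"
    "((\<lambda>t. LINT x|lborel. \<bar>(g t x - g \<theta> x) / (t - \<theta>) - d x\<bar>) \<longlongrightarrow> 0) (at \<theta>)"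
    by (rule L1_derivative_exists[OF Theta meas dens_diff])
  interpret L1_differentiable_family g \<Theta> \<theta> d
    by (rule L1_differentiable_family.intro[OF Theta family d(1,3)])
  define D where "D = (LINT x:{v<..}|lborel. d x)"
  have D: "deriv (\<lambda>t. ccdf (g t) v) \<theta> = D"
    unfolding D_def by (rule DERIV_imp_deriv) (rule ccdf_has_parameter_derivative)
  have dq: "deriv (\<lambda>t. ccdf_inv (g t) \<rho>) \<theta> = D / g \<theta> v"
    using quantile_has_derivative[OF rho] dens_pos
    unfolding v D_def by (intro DERIV_imp_deriv) blast
  have "D \<noteq> 0"
    using nondeg D by simp
  have le: "D\<^sup>2 \<le> \<rho> * (1 - \<rho>) * fisher_info g \<theta>"
    by (rule fisher_info_lower_bound[OF dens_nonneg d(2) info_finite _ rho D_def])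
       (simp_all add: v ccdf_inv[OF rho])
  \<comment> \<open>Positivity of the information follows from the lower bound, as \<open>D\<close>
    is nonzero.\<close>
  have "0 < \<rho> * (1 - \<rho>) * fisher_info g \<theta>"
    using le \<open>D \<noteq> 0\<close> by (meson less_le_trans zero_less_power2)
  then have I: "fisher_info g \<theta> > 0"
    by (rule zero_less_mult_pos) (use rho in simp)
  have mle_pos: "avar_mle g \<rho> \<theta> > 0"
    using I \<open>D \<noteq> 0\<close> dens_pos by (simp add: avar_mle_def dq)
  have np_pos: "avar_np g \<rho> \<theta> > 0"
    using rho dens_pos by (simp add: avar_np_def v)
  \<comment> \<open>Both variances carry the factor \<open>1 / (g \<theta> v)\<^sup>2\<close>, which
    cancels.\<close>
  have eff: "rel_efficiency g \<rho> \<theta> = \<rho> * (1 - \<rho>) * fisher_info g \<theta> / D\<^sup>2"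
    using dens_pos I \<open>D \<noteq> 0\<close> unfolding rel_efficiency_def avar_np_def avar_mle_def dq v
    by (simp add: power_divide divide_simps)
  have ge: "rel_efficiency g \<rho> \<theta> \<ge> 1"
    unfolding eff using le \<open>D \<noteq> 0\<close> by simp
  obtain a b where a: "a > 0" and J: "Jbar (g \<theta>) \<rho> \<in> borel_measurable borel"
    and left: "(Jbar (g \<theta>) \<rho> has_real_derivative a) (at_left v)"
    and right: "(Jbar (g \<theta>) \<rho> has_real_derivative b) (at_right v)"
    using Jbar_one_sided_derivatives[OF rho mean] dens_pos unfolding v by blast
  have pos: "kink_variance a b > 0"
    using a by (intro kink_variance_pos) simp
  have "has_limiting_variance P
      (\<lambda>M \<omega>. sqrt (real M) * (Jbar (g \<theta>) \<rho> (vhat M \<omega>) - Jbar (g \<theta>) \<rho> v)) (avar_np g \<rho> \<theta> * kink_variance a b)"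
    by (rule delta_method_kink[OF P np_meas np_normal np_pos J left right])
  moreover have "has_limiting_variance P
      (\<lambda>M \<omega>. sqrt (real M) * (Jbar (g \<theta>) \<rho> (vmle M \<omega>) - Jbar (g \<theta>) \<rho> v)) (avar_mle g \<rho> \<theta> * kink_variance a b)"
    by (rule delta_method_kink[OF P mle_meas(2) mle_normal mle_pos J left right])
  moreover have "avar_mle g \<rho> \<theta> * kink_variance a b > 0"
    using mle_pos pos by (rule mult_pos_pos)
  moreover have "rel_efficiency g \<rho> \<theta>
      = (avar_np g \<rho> \<theta> * kink_variance a b) / (avar_mle g \<rho> \<theta> * kink_variance a b)"
    using pos by (simp add: rel_efficiency_def)
  ultimately show ?thesis
    using eff ge unfolding D by blast
qed

end
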